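(* For every function $f:\mathbb{N}\to\mathbb{N}$ there exist a tree $T$ of maximum degree $3$ and an $f(3)$-edge-connected graph $G$ with minimum degree at least $f(|E(T)|)$ and with $|E(G)|$ divisible by $|E(T)|$ such that $G$ has no $T$-decomposition. In particular, there is no function $f$ such that for every tree $T$ with maximum degree $\Delta_T$, every $f(\Delta_T)$-edge-connected graph with minimum degree at least $f(|E(T)|)$ and number of edges divisible by $|E(T)|$ has a $T$-decomposition.
   Context: Graphs are finite and simple (no loops, no multiple edges). A $T$-decomposition of a graph $G$ is a partition $\{E_i\}_{i\in[k]}$ of $E(G)$ such that each $E_i$ forms an isomorphic copy of $T$. A graph is $k$-edge-connected if it has at least two vertices and, for every partition of its vertex set into two nonempty parts, at least $k$ edges have an endpoint in each part. *)

theory Defs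
  imports Main "HOL-Library.Disjoint_Sets"
begin

record 'a graph =
  verts :: "'a set"
  edges :: "'a set set"

definition simple_graph :: "'a graph \<Rightarrow> bool" where
  "simple_graph G \<longleftrightarrow>
     finite (verts G) \<and> (\<forall>e\<in>edges G. e \<subseteq> verts G \<and> card e = 2)"

definition degree :: "'a graph \<Rightarrow> 'a \<Rightarrow> nat" where
  "degree G v = card {e \<in> edges G. v \<in> e}"

text \<open>These are meaningful for finite graphs with at least one vertex.\<close>

definition max_degree :: "'a graph \<Rightarrow> nat" where
  "max_degree G = Max (degree G ` verts G)"

definition min_degree :: "'a graph \<Rightarrow> nat" where
  "min_degree G = Min (degree G ` verts G)"

definition adjacent :: "'a graph \<Rightarrow> 'a \<Rightarrow> 'a \<Rightarrow> bool" where
  "adjacent G u v \<longleftrightarrow> {u, v} \<in> edges G"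

definition connected_graph :: "'a graph \<Rightarrow> bool" where
  "connected_graph G \<longleftrightarrow>
     verts G \<noteq> {} \<and> (\<forall>u\<in>verts G. \<forall>v\<in>verts G. (adjacent G)\<^sup>*\<^sup>* u v)"

definition is_cycle :: "'a graph \<Rightarrow> 'a list \<Rightarrow> bool" where
  "is_cycle G c \<longleftrightarrow>
     length c \<ge> 3 \<and> distinct c \<and>
     (\<forall>i<length c. adjacent G (c ! i) (c ! (Suc i mod length c)))"

definition tree :: "'a graph \<Rightarrow> bool" where
  "tree T \<longleftrightarrow> simple_graph T \<and> connected_graph T \<and> (\<nexists>c. is_cycle T c)"

definition edge_connected :: "nat \<Rightarrow> 'a graph \<Rightarrow> bool" where
  "edge_connected k G \<longleftrightarrow>
     card (verts G) \<ge> 2 \<and>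
     (\<forall>A B. A \<noteq> {} \<and> B \<noteq> {} \<and> A \<inter> B = {} \<and> A \<union> B = verts G \<longrightarrow>
        card {e \<in> edges G. e \<inter> A \<noteq> {} \<and> e \<inter> B \<noteq> {}} \<ge> k)"

definition graph_isomorphic :: "'a graph \<Rightarrow> 'b graph \<Rightarrow> bool" where
  "graph_isomorphic G H \<longleftrightarrow>
     (\<exists>h. bij_betw h (verts G) (verts H) \<and>
        (\<forall>u\<in>verts G. \<forall>v\<in>verts G. {u, v} \<in> edges G \<longleftrightarrow> {h u, h v} \<in> edges H))"

text \<open>The graph formed by a set of edges has exactly the endpoints of these edges as vertices.\<close>

definition edge_induced :: "'a set set \<Rightarrow> 'a graph" where
  "edge_induced F = \<lparr>verts = \<Union>F, edges = F\<rparr>"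

definition is_decomposition :: "'b graph \<Rightarrow> 'a graph \<Rightarrow> 'a set set set \<Rightarrow> bool" where
  "is_decomposition T G P \<longleftrightarrow>
     partition_on (edges G) P \<and> (\<forall>F\<in>P. graph_isomorphic T (edge_induced F))"

definition has_decomposition :: "'b graph \<Rightarrow> 'a graph \<Rightarrow> bool" where
  "has_decomposition T G \<longleftrightarrow> (\<exists>P. is_decomposition T G P)"

end

(* Let T be the complete binary tree of depth D, with m edges, and let G consist of two almost
   complete graphs A and B joined by K edges. In a T-decomposition of G, each of the K edges of
   the cut splits its copy of T into a subtree and the rest, and subtrees have only D different
   sizes; so each cut edge contributes one of at most 2D values to the number of edges of A
   modulo m. There are at most (2D)^K sums of such values, which is less than m for large D, so
   some residue is not attained; removing fewer than m edges from a complete graph yields an A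
   with this residue, and removing fewer than m edges from the other one makes m divide |E(G)|. *)

theory Submission
  imports Defs "HOL-Library.Discrete_Functions"
begin

section \<open>Complete binary trees\<close>

text \<open>Vertices are numbered as in a binary heap: the parent of \<open>v\<close> is \<open>v div 2\<close>.\<close>

definition heap_tree :: "nat \<Rightarrow> nat graph" where
  "heap_tree N = \<lparr>verts = {1..N}, edges = (\<lambda>v. {v div 2, v}) ` {2..N}\<rparr>"

lemma verts_heap_tree [simp]: "verts (heap_tree N) = {1..N}"
  by (simp add: heap_tree_def)

lemma edges_heap_tree: "edges (heap_tree N) = (\<lambda>v. {v div 2, v}) ` {2..N}"
  by (simp add: heap_tree_def)

text \<open>The lower end \<open>v\<close> is the larger number and so determines the edge. Sums
  over edges thereby become sums over the non-root vertices \<open>{2..N}\<close>.\<close>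

lemma inj_on_parent_edge: "inj_on (\<lambda>v::nat. {v div 2, v}) {2..N}"
proof (rule inj_onI)
  fix u v :: nat assume "{u div 2, u} = {v div 2, v}"
  then have "u = v \<or> (u div 2 = v \<and> u = v div 2)"
    by (auto simp: doubleton_eq_iff)
  moreover have "u div 2 \<le> u" "v div 2 \<le> v" by simp_all
  ultimately show "u = v" by linarith
qed

lemma card_edges_heap_tree: "card (edges (heap_tree N)) = N - 1"
  by (simp add: edges_heap_tree card_image[OF inj_on_parent_edge])

lemma simple_graph_heap_tree: "simple_graph (heap_tree N)"
  by (auto simp: simple_graph_def edges_heap_tree card_2_iff')

lemma adjacent_heap_tree:
  "adjacent (heap_tree N) u v \<longleftrightarrow>
     (v \<in> {2..N} \<and> u = v div 2) \<or> (u \<in> {2..N} \<and> v = u div 2)"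
  by (auto simp: adjacent_def edges_heap_tree doubleton_eq_iff image_iff)

lemma connected_graph_heap_tree:
  assumes "N \<ge> 1"
  shows "connected_graph (heap_tree N)"
proof -
  let ?R = "adjacent (heap_tree N)"
  have "symp ?R" by (auto simp: symp_def adjacent_heap_tree)
  then have sym: "?R\<^sup>*\<^sup>* u v \<Longrightarrow> ?R\<^sup>*\<^sup>* v u" for u v
    by (metis sympD symp_rtranclp)
  have root: "?R\<^sup>*\<^sup>* 1 v" if "v \<in> {1..N}" for v
    using that
  proof (induction v rule: less_induct)
    case (less v)
    show ?case
    proof (cases "v = 1")
      case False
      with less.prems have "?R\<^sup>*\<^sup>* 1 (v div 2)" by (intro less.IH) auto
      moreover have "?R (v div 2) v"
        using False less.prems by (auto simp: adjacent_heap_tree)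
      ultimately show ?thesis by (rule rtranclp.rtrancl_into_rtrancl)
    qed simp
  qed
  show ?thesis
    unfolding connected_graph_def
  proof (intro conjI ballI)
    show "verts (heap_tree N) \<noteq> {}" using assms by simp
    fix u v assume "u \<in> verts (heap_tree N)" "v \<in> verts (heap_tree N)"
    then show "?R\<^sup>*\<^sup>* u v"
      using rtranclp_trans[OF sym[OF root] root] by simp
  qed
qed

text \<open>Both neighbours of the largest vertex of a cycle would be its parent.\<close>

lemma acyclic_heap_tree: "\<not> is_cycle (heap_tree N) c"
proof
  assume cyc: "is_cycle (heap_tree N) c"
  let ?n = "length c"
  have n: "?n \<ge> 3" and d: "distinct c"
    and adj: "\<And>i. i < ?n \<Longrightarrow> adjacent (heap_tree N) (c ! i) (c ! (Suc i mod ?n))"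
    using cyc by (auto simp: is_cycle_def)
  have "c \<noteq> []" using n by auto
  then have "Max (set c) \<in> set c" by simp
  then obtain i where i: "i < ?n" "c ! i = Max (set c)" by (metis in_set_conv_nth)
  \<comment> \<open>\<open>j\<close> and \<open>k\<close> are the cyclic predecessor and successor
    of the position \<open>i\<close> of the largest vertex; they differ because the cycle has length
    at least 3.\<close>
  define j where "j = (if i = 0 then ?n - 1 else i - 1)"
  define k where "k = Suc i mod ?n"
  have j: "j < ?n" "Suc j mod ?n = i" using i n by (auto simp: j_def)
  have "?n > 0" using n by linarith
  then have k: "k < ?n" unfolding k_def by (rule mod_less_divisor)
  have "j \<noteq> k"
    using n i by (cases "Suc i = ?n") (auto simp: j_def k_def)
  have le: "c ! l \<le> c ! i" if "l < ?n" for l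
    using that i by simp
  have "c ! j = c ! i div 2"
    using adj[OF j(1)] le[OF j(1)] by (auto simp: adjacent_heap_tree j)
  moreover have "c ! k = c ! i div 2"
    using adj[OF i(1)] le[OF k] by (auto simp: adjacent_heap_tree simp flip: k_def)
  ultimately show False
    using d j(1) k \<open>j \<noteq> k\<close> by (metis nth_eq_iff_index_eq)
qed

lemma tree_heap_tree: "N \<ge> 1 \<Longrightarrow> tree (heap_tree N)"
  by (simp add: tree_def simple_graph_heap_tree connected_graph_heap_tree acyclic_heap_tree)

lemma max_degree_heap_tree:
  assumes "N \<ge> 5"
  shows "max_degree (heap_tree N) = 3"
  unfolding max_degree_def
proof (rule Max_eqI)
  fix y assume "y \<in> degree (heap_tree N) ` verts (heap_tree N)"
  then obtain v where y: "y = degree (heap_tree N) v" by auto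
  \<comment> \<open>The candidates are the edge to the parent and the edges to the two children; for
    the root and for leaves some of them are absent.\<close>
  have "{e \<in> edges (heap_tree N). v \<in> e} \<subseteq> {{v div 2, v}, {v, 2 * v}, {v, 2 * v + 1}}"
  proof
    fix e assume "e \<in> {e \<in> edges (heap_tree N). v \<in> e}"
    then obtain u where "e = {u div 2, u}" "v = u \<or> v = u div 2"
      by (auto simp: edges_heap_tree)
    moreover have "u = 2 * v \<or> u = 2 * v + 1" if "v = u div 2" using that by presburger
    ultimately show "e \<in> {{v div 2, v}, {v, 2 * v}, {v, 2 * v + 1}}" by auto
  qed
  then have "y \<le> card {{v div 2, v}, {v, 2 * v}, {v, 2 * v + 1}}"
    unfolding y degree_def by (rule card_mono[rotated]) simp
  also have "\<dots> \<le> 3" using card_length[of "[{v div 2, v}, {v, 2 * v}, {v, 2 * v + 1}]"] by simp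
  finally show "y \<le> 3" .
next
  \<comment> \<open>Vertex 2 is the first with both a parent and two children, as
    \<open>5 \<le> N\<close>.\<close>
  have "{v \<in> {2..N}. 2 \<in> {v div 2, v}} = {2, 4, 5}"
    using assms by auto
  then have "{e \<in> edges (heap_tree N). 2 \<in> e} = (\<lambda>v. {v div 2, v}) ` {2, 4, 5}"
    unfolding edges_heap_tree by blast
  also have "card \<dots> = 3"
    using card_image[OF inj_on_subset[OF inj_on_parent_edge[of 5], of "{2,4,5}"]] by simp
  finally have "degree (heap_tree N) 2 = 3" by (simp add: degree_def)
  then show "3 \<in> degree (heap_tree N) ` verts (heap_tree N)"
    using assms by (intro image_eqI[of _ _ 2]) simp_all
qed simp

section \<open>Subtree sizes\<close>

text \<open>Summation by parts on the tree. Grouping the edges by upper end \<open>u\<close>, the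
  weights of the children of \<open>u\<close> add up to \<open>w u - 1\<close>. This cancels against
  \<open>w u\<close> up to 1, except at the root, which has no edge above it.\<close>

lemma sum_parent_telescope:
  fixes w a :: "nat \<Rightarrow> int"
  assumes w: "\<And>v. v \<in> {1..N} \<Longrightarrow> w v = 1 + (\<Sum>u | u \<in> {2..N} \<and> u div 2 = v. w u)"
    and "N \<ge> 1"
  shows "(\<Sum>v\<in>{2..N}. (a v - a (v div 2)) * w v) = (\<Sum>v\<in>{2..N}. a v) - a 1 * (w 1 - 1)"
proof -
  have "(\<Sum>v\<in>{2..N}. a (v div 2) * w v)
      = (\<Sum>u\<in>{1..N}. \<Sum>v | v \<in> {2..N} \<and> v div 2 = u. a (v div 2) * w v)"
    by (rule sum.group[symmetric, of "{2..N}" "{1..N}" "\<lambda>v. v div 2"]) auto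
  also have "\<dots> = (\<Sum>u\<in>{1..N}. a u * (w u - 1))"
  proof (intro sum.cong refl)
    fix u assume "u \<in> {1..N}"
    then have "(\<Sum>v | v \<in> {2..N} \<and> v div 2 = u. w v) = w u - 1" using w[of u] by linarith
    moreover have "(\<Sum>v | v \<in> {2..N} \<and> v div 2 = u. a (v div 2) * w v)
        = a u * (\<Sum>v | v \<in> {2..N} \<and> v div 2 = u. w v)"
      by (subst sum_distrib_left) (rule sum.cong, simp_all)
    ultimately show "(\<Sum>v | v \<in> {2..N} \<and> v div 2 = u. a (v div 2) * w v) = a u * (w u - 1)"
      by simp
  qed
  also have "{1..N} = insert 1 {2..N}" using \<open>N \<ge> 1\<close> by auto
  finally have "(\<Sum>v\<in>{2..N}. a (v div 2) * w v)
      = a 1 * (w 1 - 1) + (\<Sum>u\<in>{2..N}. a u * (w u - 1))" by simp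
  moreover have "(\<Sum>u\<in>{2..N}. a u * (w u - 1)) = (\<Sum>u\<in>{2..N}. a u * w u) - (\<Sum>u\<in>{2..N}. a u)"
    by (simp add: right_diff_distrib sum_subtractf)
  moreover have "(\<Sum>v\<in>{2..N}. (a v - a (v div 2)) * w v)
      = (\<Sum>v\<in>{2..N}. a v * w v) - (\<Sum>v\<in>{2..N}. a (v div 2) * w v)"
    by (simp add: left_diff_distrib sum_subtractf)
  ultimately show ?thesis by linarith
qed

text \<open>The depth of \<open>v\<close> is \<open>floor_log v\<close>, so the subtree below
  \<open>v\<close> is complete with \<open>D + 1 - floor_log v\<close> levels. Integer values allow
  signed contributions.\<close>

definition subtree_size :: "nat \<Rightarrow> nat \<Rightarrow> int" where
  "subtree_size D v = 2 ^ (D + 1 - floor_log v) - 1"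

text \<open>Since the last level is full, vertices below \<open>2 ^ D\<close> have both children,
  and the others are leaves.\<close>

lemma subtree_size_rec:
  assumes N: "N = 2 ^ (D + 1) - 1" and v: "v \<in> {1..N}"
  shows "subtree_size D v = 1 + (\<Sum>u | u \<in> {2..N} \<and> u div 2 = v. subtree_size D u)"
proof -
  have N': "N = 2 * 2 ^ D - 1" by (simp add: N)
  show ?thesis
  proof (cases "v < 2 ^ D")
    case True
    have "2 * v + 1 \<le> N" using True N' by linarith
    then have children: "{u. u \<in> {2..N} \<and> u div 2 = v} = {2 * v, 2 * v + 1}"
      using v by auto
    have log: "floor_log (2 * v) = Suc (floor_log v)" "floor_log (2 * v + 1) = Suc (floor_log v)"
      using v floor_log_rec[of "2 * v + 1"] by simp_all
    have "2 ^ floor_log v \<le> v" using v by (intro floor_log_exp2_le) auto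
    also note True
    finally have "floor_log v < D" by (rule power_less_imp_less_exp[rotated]) simp
    then have depth: "D + 1 - floor_log v = Suc (D - floor_log v)" by simp
    show ?thesis unfolding children subtree_size_def depth using log by simp
  next
    case False
    have "1 \<le> v" "v \<le> N" using v by simp_all
    then have "v < 2 * 2 ^ D" using N' by linarith
    then have leaf: "floor_log v = D"
      using False v by (intro floor_log_eqI) simp_all
    have "u div 2 \<noteq> v" if "u \<in> {2..N}" for u using that False N' by auto
    then have children: "{u. u \<in> {2..N} \<and> u div 2 = v} = {}" by blast
    show ?thesis unfolding children by (simp add: subtree_size_def leaf)
  qed
qed

text \<open>
  With \<open>w = 2 ^ i - 1\<close> the size of the subtree below a cut edge, the contribution of that edge
  is \<open>w - 1\<close> if its lower end lies in the chosen side and \<open>- w\<close> otherwise.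
\<close>

definition cut_values :: "nat \<Rightarrow> int set" where
  "cut_values D = (\<lambda>i. 2 ^ i - 2) ` {1..D} \<union> (\<lambda>i. 1 - 2 ^ i) ` {1..D}"

lemma card_cut_values: "card (cut_values D) \<le> 2 * D" and finite_cut_values: "finite (cut_values D)"
proof -
  have "card (cut_values D) \<le> card {1..D} + card {1..D}"
    unfolding cut_values_def
    by (intro order_trans[OF card_Un_le] add_mono card_image_le) auto
  then show "card (cut_values D) \<le> 2 * D" by simp
  show "finite (cut_values D)" by (simp add: cut_values_def)
qed

lemma subtree_size_cut_values:
  assumes "v \<in> {2..2 ^ (D + 1) - 1}"
  shows "subtree_size D v - 1 \<in> cut_values D" "- subtree_size D v \<in> cut_values D"
proof -
  have "2 ^ floor_log v \<le> v" using assms by (intro floor_log_exp2_le) auto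
  also have "v < 2 ^ (D + 1)" using assms by auto
  finally have "floor_log v < D + 1" by (rule power_less_imp_less_exp[rotated]) simp
  \<comment> \<open>Only non-root vertices have an edge above them, so depth 0 is excluded and just
    \<open>D\<close> exponents remain.\<close>
  moreover have "floor_log v \<ge> 1"
    using assms floor_log_rec[of v] by simp
  ultimately have "D + 1 - floor_log v \<in> {1..D}" by auto
  then show "subtree_size D v - 1 \<in> cut_values D" "- subtree_size D v \<in> cut_values D"
    unfolding cut_values_def subtree_size_def by (auto simp: image_iff)
qed

section \<open>Copies of the tree meeting a cut\<close>

definition crosses :: "'a set \<Rightarrow> 'a set \<Rightarrow> bool" where
  "crosses A e \<longleftrightarrow> \<not> e \<subseteq> A \<and> e \<inter> A \<noteq> {}"

text \<open>This names the edges of a copy by the lower ends of tree edges. The isomorphism only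
  compares sets of the form \<open>{u, v}\<close>; \<open>card e = 2\<close> lets every member of
  \<open>F\<close> be written so.\<close>

lemma iso_edges_bij:
  assumes iso: "graph_isomorphic (heap_tree N) (edge_induced F)" and F: "\<And>e. e \<in> F \<Longrightarrow> card e = 2"
  obtains h where "bij_betw (\<lambda>v. {h (v div 2), h v}) {2..N} F"
proof -
  obtain h where h: "bij_betw h {1..N} (\<Union>F)"
    and e: "\<And>u v. u \<in> {1..N} \<Longrightarrow> v \<in> {1..N} \<Longrightarrow>
        {u, v} \<in> edges (heap_tree N) \<longleftrightarrow> {h u, h v} \<in> F"
    using iso by (auto simp: graph_isomorphic_def edge_induced_def)
  have "bij_betw ((`) h) (edges (heap_tree N)) F"
  proof (rule bij_betw_imageI)
    have "edges (heap_tree N) \<subseteq> Pow {1..N}" by (auto simp: edges_heap_tree)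
    then show "inj_on ((`) h) (edges (heap_tree N))"
      using h by (meson bij_betw_imp_inj_on inj_on_image_Pow inj_on_subset)
    show "(`) h ` edges (heap_tree N) = F"
    proof (intro equalityI subsetI)
      fix x assume "x \<in> (`) h ` edges (heap_tree N)"
      then obtain v where "v \<in> {2..N}" "x = {h (v div 2), h v}"
        by (auto simp: edges_heap_tree)
      then show "x \<in> F" using e[of "v div 2" v] by (force simp: edges_heap_tree)
    next
      fix x assume x: "x \<in> F"
      then obtain p q where pq: "x = {p, q}" by (meson F card_2_iff)
      then have "p \<in> h ` {1..N}" "q \<in> h ` {1..N}"
        using x h by (auto simp: bij_betw_def)
      then obtain u v where "u \<in> {1..N}" "v \<in> {1..N}" "p = h u" "q = h v" by auto
      then show "x \<in> (`) h ` edges (heap_tree N)"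
        using e[of u v] x pq by (intro image_eqI[of _ _ "{u, v}"]) auto
    qed
  qed
  moreover have "bij_betw (\<lambda>v. {v div 2, v}) {2..N} (edges (heap_tree N))"
    by (simp add: bij_betw_def edges_heap_tree inj_on_parent_edge)
  ultimately have "bij_betw ((`) h \<circ> (\<lambda>v. {v div 2, v})) {2..N} F"
    by (rule bij_betw_trans[rotated])
  then show thesis by (intro that[of h]) (simp add: comp_def)
qed

text \<open>Start with all edges of the copy inside \<open>A\<close> or with none, according to the
  root, and walk down. Leaving \<open>A\<close> along an edge with \<open>w\<close> vertices below
  loses \<open>w\<close> edges, the cut edge included; entering \<open>A\<close> gains the
  \<open>w - 1\<close> edges below. So the edges inside \<open>A\<close>, minus these corrections,
  number 0 or all.\<close>

lemma copy_cut_contribution: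
  fixes A :: "'a set"
  assumes iso: "graph_isomorphic (heap_tree (2 ^ (D + 1) - 1)) (edge_induced F)"
    and F: "\<And>e. e \<in> F \<Longrightarrow> card e = 2"
  shows "\<exists>c. (\<forall>e\<in>F. c e \<in> cut_values D) \<and>
    int (2 ^ (D + 1) - 2) dvd (\<Sum>e\<in>F. of_bool (e \<subseteq> A) - (if crosses A e then c e else 0))"
proof -
  define N :: nat where "N = 2 ^ (D + 1) - 1"
  define w where "w = subtree_size D"
  have "(2::nat) ^ 1 \<le> 2 ^ (D + 1)" by (intro power_increasing) auto
  then have "N \<ge> 1" unfolding N_def power_one_right by linarith
  obtain h where bij: "bij_betw (\<lambda>v. {h (v div 2), h v}) {2..N} F"
    using iso_edges_bij[OF iso F] unfolding N_def by blast
  define g where "g v = {h (v div 2), h v}" for v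
  have bij: "bij_betw g {2..N} F" using bij by (simp add: g_def[abs_def])
  define a :: "nat \<Rightarrow> int" where "a v = of_bool (h v \<in> A)" for v
  define b where "b v = (if h v \<in> A then w v - 1 else - w v)" for v
  \<comment> \<open>The corrections are indexed by lower ends; \<open>c\<close> transfers them to
    the edges of the copy.\<close>
  define c where "c = b \<circ> inv_into {2..N} g"
  have cg: "c (g v) = b v" if "v \<in> {2..N}" for v
    using that bij by (simp add: c_def bij_betw_def)
  have "c e \<in> cut_values D" if "e \<in> F" for e
  proof -
    obtain v where "v \<in> {2..N}" "e = g v" using \<open>e \<in> F\<close> bij unfolding bij_betw_def by blast
    then show ?thesis
      using cg subtree_size_cut_values[of v D] by (simp add: b_def w_def N_def)
  qed
  moreover have "int (2 ^ (D + 1) - 2) dvd (\<Sum>e\<in>F. of_bool (e \<subseteq> A) - (if crosses A e then c e else 0))"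
  proof -
    have w: "w v = 1 + (\<Sum>u | u \<in> {2..N} \<and> u div 2 = v. w u)" if "v \<in> {1..N}" for v
      using subtree_size_rec[OF N_def that] by (simp only: w_def)
    have "(\<Sum>e\<in>F. of_bool (e \<subseteq> A) - (if crosses A e then c e else 0))
        = (\<Sum>v\<in>{2..N}. of_bool (g v \<subseteq> A) - (if crosses A (g v) then c (g v) else 0))"
      by (rule sum.reindex_bij_betw[OF bij, symmetric])
    \<comment> \<open>The values of \<open>b\<close> are chosen to make this hold in each of the
      four positions of the two ends relative to \<open>A\<close>.\<close>
    also have "\<dots> = (\<Sum>v\<in>{2..N}. a v - (a v - a (v div 2)) * w v)"
    proof (intro sum.cong refl)
      fix v assume v: "v \<in> {2..N}"
      have "g v \<subseteq> A \<longleftrightarrow> h v \<in> A \<and> h (v div 2) \<in> A"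
        "crosses A (g v) \<longleftrightarrow> (h v \<in> A) \<noteq> (h (v div 2) \<in> A)"
        by (auto simp: g_def crosses_def)
      then show "of_bool (g v \<subseteq> A) - (if crosses A (g v) then c (g v) else 0)
          = a v - (a v - a (v div 2)) * w v"
        by (simp add: cg[OF v] a_def b_def)
    qed
    \<comment> \<open>After telescoping, only the side of the root matters.\<close>
    also have "\<dots> = a 1 * (w 1 - 1)"
      using sum_parent_telescope[OF w \<open>N \<ge> 1\<close>, of a] by (simp add: sum_subtractf)
    also have "w 1 - 1 = int (2 ^ (D + 1) - 2)"
      by (simp add: w_def subtree_size_def of_nat_diff)
    finally show ?thesis by simp
  qed
  ultimately show ?thesis by blast
qed

text \<open>Add the divisibilities of all copies: the parts are disjoint and cover
  \<open>edges G\<close>, so each edge inside \<open>A\<close> and each cut edge is counted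
  once.\<close>

lemma decomposition_cut_residue:
  assumes G: "simple_graph G" and dec: "has_decomposition (heap_tree (2 ^ (D + 1) - 1)) G"
  shows "\<exists>c. (\<forall>e\<in>edges G. c e \<in> cut_values D) \<and>
    int (2 ^ (D + 1) - 2) dvd
      (int (card {e \<in> edges G. e \<subseteq> A}) - (\<Sum>e | e \<in> edges G \<and> crosses A e. c e))"
proof -
  let ?t = "\<lambda>c e. of_bool (e \<subseteq> A) - (if crosses A e then c e else (0::int))"
  have "edges G \<subseteq> Pow (verts G)" "finite (verts G)" using G by (auto simp: simple_graph_def)
  then have fin: "finite (edges G)" by (meson finite_Pow_iff finite_subset)
  obtain P where part: "partition_on (edges G) P"
    and iso: "\<And>F. F \<in> P \<Longrightarrow> graph_isomorphic (heap_tree (2 ^ (D + 1) - 1)) (edge_induced F)"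
    using dec by (auto simp: has_decomposition_def is_decomposition_def)
  have U: "\<Union>P = edges G" and disj: "\<And>F F'. F \<in> P \<Longrightarrow> F' \<in> P \<Longrightarrow> F \<noteq> F' \<Longrightarrow> F \<inter> F' = {}"
    using part by (auto simp: partition_on_def disjoint_def)
  have "\<forall>F\<in>P. \<exists>c. (\<forall>e\<in>F. c e \<in> cut_values D) \<and> int (2 ^ (D + 1) - 2) dvd (\<Sum>e\<in>F. ?t c e)"
  proof
    fix F assume "F \<in> P"
    then have "card e = 2" if "e \<in> F" for e
      using that U G by (auto simp: simple_graph_def)
    then show "\<exists>c. (\<forall>e\<in>F. c e \<in> cut_values D) \<and> int (2 ^ (D + 1) - 2) dvd (\<Sum>e\<in>F. ?t c e)"
      using copy_cut_contribution[OF iso[OF \<open>F \<in> P\<close>], of A] by simp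
  qed
  from bchoice[OF this] obtain d where
    *: "\<forall>F\<in>P. (\<forall>e\<in>F. d F e \<in> cut_values D) \<and> int (2 ^ (D + 1) - 2) dvd (\<Sum>e\<in>F. ?t (d F) e)" ..
  then have d: "\<And>F e. F \<in> P \<Longrightarrow> e \<in> F \<Longrightarrow> d F e \<in> cut_values D" by blast
  have dvd: "\<And>F. F \<in> P \<Longrightarrow> int (2 ^ (D + 1) - 2) dvd (\<Sum>e\<in>F. ?t (d F) e)" using * by blast
  \<comment> \<open>The choices made for the single copies are glued along the unique part
    containing \<open>e\<close>.\<close>
  define c where "c e = d (THE F. F \<in> P \<and> e \<in> F) e" for e
  have c: "c e = d F e" if "F \<in> P" "e \<in> F" for F e
  proof -
    have "(THE F. F \<in> P \<and> e \<in> F) = F" using that disj by (intro the_equality) auto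
    then show ?thesis by (simp add: c_def)
  qed
  have "int (card {e \<in> edges G. e \<subseteq> A}) - (\<Sum>e | e \<in> edges G \<and> crosses A e. c e)
      = (\<Sum>e\<in>edges G. ?t c e)"
  proof -
    have "{e \<in> edges G. e \<subseteq> A} = edges G \<inter> {e. e \<subseteq> A}" by blast
    then show ?thesis
      unfolding sum_subtractf sum.inter_filter[OF fin] by (simp add: fin)
  qed
  also have "\<dots> = (\<Sum>F\<in>P. \<Sum>e\<in>F. ?t c e)"
    using fin disj U
    by (subst U[symmetric], subst sum.Union_disjoint) (auto intro: finite_subset)
  also have "\<dots> = (\<Sum>F\<in>P. \<Sum>e\<in>F. ?t (d F) e)"
    using c by (intro sum.cong refl) simp
  finally have "int (2 ^ (D + 1) - 2) dvd
      (int (card {e \<in> edges G. e \<subseteq> A}) - (\<Sum>e | e \<in> edges G \<and> crosses A e. c e))"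
    using dvd by (simp add: dvd_sum)
  moreover have "\<forall>e\<in>edges G. c e \<in> cut_values D" using c d unfolding U[symmetric] by force
  ultimately show ?thesis by blast
qed

section \<open>Unattainable residues\<close>

text \<open>With \<open>D\<close> a power of 2, both sides can be compared by their exponents:
  \<open>(2 * s + 1) * K < (s + 1)\<^sup>2 \<le> 4 ^ s = D\<close>, where the first inequality
  dictates \<open>s = 2 * K + 1\<close>.\<close>

lemma power_lt_exponential: "\<exists>D::nat. D \<ge> 2 \<and> (2 * D) ^ K < 2 ^ (D + 1) - 2"
proof -
  define s where "s = 2 * K + 1"
  define D :: nat where "D = 2 ^ (2 * s)"
  have D: "D = 2 ^ s * 2 ^ s" unfolding D_def mult_2 power_add ..
  have "s + 1 \<le> 2 ^ s" unfolding Suc_eq_plus1[symmetric] Suc_le_eq by (rule less_exp)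
  then have "(s + 1) * (s + 1) \<le> D" unfolding D by (intro mult_mono) auto
  moreover have "(2 * s + 1) * K < (s + 1) * (s + 1)" by (simp add: s_def algebra_simps)
  ultimately have "(2 * s + 1) * K < D" by linarith
  then have "(2::nat) ^ ((2 * s + 1) * K) < 2 ^ D" by (intro power_strict_increasing) auto
  moreover have "(2 * D) ^ K = 2 ^ ((2 * s + 1) * K)"
    unfolding power_mult by (simp add: D_def)
  moreover have "s \<ge> 1" by (simp add: s_def)
  then have "(2::nat) ^ 1 \<le> 2 ^ (2 * s)" by (intro power_increasing) auto
  then have "D \<ge> 2" by (simp add: D_def)
  moreover from this have "(2::nat) ^ 1 \<le> 2 ^ D" by (intro power_increasing) auto
  ultimately have "D \<ge> 2" "(2 * D) ^ K < 2 ^ D" "(2::nat) ^ D \<le> 2 ^ (D + 1) - 2" by simp_all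
  then show ?thesis by (meson less_le_trans)
qed

lemma exists_unattainable_residue:
  fixes C :: "int set" and S :: "'a set"
  assumes "finite S" "finite C" "card C ^ card S < m"
  shows "\<exists>r<m. \<forall>c. (\<forall>e\<in>S. c e \<in> C) \<longrightarrow> \<not> int m dvd (int r - (\<Sum>e\<in>S. c e))"
proof -
  \<comment> \<open>The attained residues. Extensional functions keep their number at most
    \<open>card C ^ card S\<close>; restricting \<open>c\<close> to \<open>S\<close> does not change
    its sum.\<close>
  define R where "R = (\<lambda>c. nat ((\<Sum>e\<in>S. c e) mod int m)) ` (S \<rightarrow>\<^sub>E C)"
  have "card R \<le> card (S \<rightarrow>\<^sub>E C)"
    unfolding R_def using assms by (intro card_image_le finite_PiE) auto
  also have "\<dots> < card {..<m}" using assms by (simp add: card_PiE)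
  finally have "\<not> {..<m} \<subseteq> R"
    unfolding R_def using assms by (meson card_mono finite_PiE finite_imageI leD)
  then obtain r where r: "r < m" "r \<notin> R" by auto
  have False if c: "\<forall>e\<in>S. c e \<in> C" and "int m dvd (int r - (\<Sum>e\<in>S. c e))" for c
  proof -
    have "(\<Sum>e\<in>S. c e) mod int m = int r"
      using that(2) r by (metis mod_eq_dvd_iff mod_pos_pos_trivial of_nat_0_le_iff of_nat_less_iff)
    moreover have "(\<Sum>e\<in>S. restrict c S e) = (\<Sum>e\<in>S. c e)" by simp
    moreover have "restrict c S \<in> S \<rightarrow>\<^sub>E C" using c by auto
    ultimately have "r \<in> R" unfolding R_def by (metis (mono_tags, lifting) image_iff nat_int)
    with r show False by simp
  qed
  with r show ?thesis by blast
qed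

section \<open>Two almost complete graphs joined by few edges\<close>

definition pairs :: "'a set \<Rightarrow> 'a set set" where
  "pairs X = {e. e \<subseteq> X \<and> card e = 2}"

lemma finite_pairs: "finite X \<Longrightarrow> finite (pairs X)"
  by (simp add: pairs_def)

lemma exists_subset_card_mod:
  assumes "finite S" "r < m" "m \<le> card S"
  shows "\<exists>E\<subseteq>S. card E mod m = r \<and> card (S - E) < m"
proof -
  \<comment> \<open>Deleting \<open>q\<close> elements leaves a number congruent to
    \<open>r\<close>, and \<open>q < m\<close>.\<close>
  define q where "q = (card S - r) mod m"
  have q: "q < m" using assms by (simp add: q_def)
  then have "card S - q \<le> card S" "q \<le> card S" using assms by auto
  then obtain E where E: "E \<subseteq> S" "card E = card S - q" by (meson obtain_subset_with_card_n)
  have "card S - r = q + m * ((card S - r) div m)" by (simp add: q_def)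
  then have "card E = r + m * ((card S - r) div m)" using E assms by linarith
  then have "card E mod m = r" using assms by simp
  moreover have "card (S - E) = q"
    using E \<open>q \<le> card S\<close> assms by (simp add: card_Diff_subset finite_subset)
  ultimately show ?thesis using E q by auto
qed

text \<open>Nonempty parts of sizes \<open>p\<close> and \<open>q\<close> have
  \<open>p * q \<ge> p + q - 1\<close> pairs between them, and fewer than \<open>m\<close> of these
  are missing from \<open>E\<close>. Both edge-connectivity and minimum degree are derived from this
  bound.\<close>

lemma cut_almost_complete:
  assumes X: "finite X" "X \<subseteq> P \<union> Q" "P \<inter> Q = {}" "P \<inter> X \<noteq> {}" "Q \<inter> X \<noteq> {}"
    and E: "card (pairs X - E) < m" "E \<subseteq> F" "finite F"
  shows "card X \<le> m + card {e \<in> F. e \<inter> P \<noteq> {} \<and> e \<inter> Q \<noteq> {}}"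
proof -
  let ?P = "P \<inter> X" and ?Q = "Q \<inter> X"
  let ?c = "{e \<in> F. e \<inter> P \<noteq> {} \<and> e \<inter> Q \<noteq> {}}"
  let ?f = "\<lambda>(p, q). {p, q}"
  have fin: "finite ?P" "finite ?Q" using X by auto
  have "card ?P \<ge> 1" "card ?Q \<ge> 1" using fin X by (simp_all add: Suc_leI card_gt_0_iff)
  then obtain p q where pq: "card ?P = Suc p" "card ?Q = Suc q"
    by (metis One_nat_def Suc_le_D)
  have "X = ?P \<union> ?Q" "?P \<inter> ?Q = {}" using X by auto
  then have "card X = card ?P + card ?Q" using fin by (metis card_Un_disjoint)
  then have "card X \<le> card ?P * card ?Q + 1" by (simp add: pq)
  also have "inj_on ?f (?P \<times> ?Q)"
    using X(3) by (auto simp: inj_on_def doubleton_eq_iff)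
  then have "card ?P * card ?Q = card (?f ` (?P \<times> ?Q))"
    by (simp add: card_image card_cartesian_product)
  also have "\<dots> \<le> card (?c \<union> (pairs X - E))"
  proof (rule card_mono)
    show "finite (?c \<union> (pairs X - E))" using X E by (simp add: finite_pairs)
    show "?f ` (?P \<times> ?Q) \<subseteq> ?c \<union> (pairs X - E)"
      using X(3) E(2) by (auto simp: pairs_def card_insert_if)
  qed
  also have "\<dots> \<le> card ?c + card (pairs X - E)" by (rule card_Un_le)
  finally show ?thesis using E by linarith
qed

text \<open>The two sides will be \<open>{..<n}\<close> and \<open>{n..<2 * n}\<close>, with
  \<open>K < n\<close>.\<close>

definition matching :: "nat \<Rightarrow> nat \<Rightarrow> nat set set" where
  "matching n K = (\<lambda>i. {i, n + i}) ` {..<K}"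

lemma card_matching: "card (matching n K) = K"
proof -
  have "inj_on (\<lambda>i. {i, n + i}) {..<K}" by (auto simp: inj_on_def doubleton_eq_iff)
  then show ?thesis by (simp add: matching_def card_image)
qed

lemma exists_graph_with_sparse_cut:
  assumes n: "n \<ge> m + K + d + 2" and r: "r < m"
  shows "\<exists>G :: nat graph. simple_graph G \<and> edge_connected K G \<and> min_degree G \<ge> d \<and>
    m dvd card (edges G) \<and> card {e \<in> edges G. e \<subseteq> {..<n}} mod m = r \<and>
    {e \<in> edges G. crosses {..<n} e} = matching n K"
proof -
  define A B where "A = {..<n}" and "B = {n..<2 * n}"
  have AB: "finite A" "finite B" "A \<inter> B = {}" "card A = n" "card B = n"
    by (auto simp: A_def B_def)
  have m_le: "m \<le> card (pairs X)" if X: "finite X" "card X = n" for X :: "nat set"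
  proof -
    have "X \<noteq> {}" using X n by auto
    then obtain x where x: "x \<in> X" by blast
    have "X \<noteq> {x}" using X n by auto
    \<comment> \<open>In the complete graph nothing is missing, so the cut bound applies with 1 in
      place of \<open>m\<close>.\<close>
    then have "card X \<le> 1 + card {e \<in> pairs X. e \<inter> {x} \<noteq> {} \<and> e \<inter> (- {x}) \<noteq> {}}"
      using X x by (intro cut_almost_complete[where E = "pairs X"]) (auto simp: finite_pairs)
    also have "\<dots> \<le> 1 + card (pairs X)"
      using X by (intro add_left_mono card_mono) (auto simp: finite_pairs)
    finally show ?thesis using X n by linarith
  qed
  \<comment> \<open>\<open>s\<close> is the residue that complements \<open>r + K\<close> to a
    multiple of \<open>m\<close>; the outer \<open>mod\<close> covers the case where
    \<open>r + K\<close> already is one.\<close>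
  define s where "s = (m - (r + K) mod m) mod m"
  have "s < m" using r by (simp add: s_def)
  have s: "m dvd r + s + K"
  proof -
    have "(r + K + s) mod m = ((r + K) mod m + (m - (r + K) mod m)) mod m"
      unfolding s_def by (simp add: mod_simps)
    also have "\<dots> = 0" using r by (simp add: less_imp_le)
    finally show ?thesis by (simp add: mod_eq_0_iff_dvd ac_simps)
  qed
  obtain EA where EA: "EA \<subseteq> pairs A" "card EA mod m = r" "card (pairs A - EA) < m"
    using exists_subset_card_mod[OF finite_pairs[OF AB(1)] r m_le] AB by blast
  obtain EB where EB: "EB \<subseteq> pairs B" "card EB mod m = s" "card (pairs B - EB) < m"
    using exists_subset_card_mod[OF finite_pairs[OF AB(2)] \<open>s < m\<close> m_le] AB by blast
  define S where "S = matching n K"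
  have S: "crosses A e" "crosses B e" "e \<subseteq> A \<union> B" "card e = 2" if "e \<in> S" for e
  proof -
    obtain i where i: "e = {i, n + i}" "i < K"
      using \<open>e \<in> S\<close> unfolding S_def matching_def by blast
    have "i \<in> A" "i \<notin> B" "n + i \<notin> A" "n + i \<in> B" "i \<noteq> n + i"
      using n i(2) by (simp_all add: A_def B_def)
    then show "crosses A e" "crosses B e" "e \<subseteq> A \<union> B" "card e = 2"
      by (simp_all add: i(1) crosses_def)
  qed
  have inA: "e \<subseteq> A" "e \<noteq> {}" if "e \<in> EA" for e using that EA by (auto simp: pairs_def)
  have inB: "e \<subseteq> B" "e \<noteq> {}" if "e \<in> EB" for e using that EB by (auto simp: pairs_def)
  define F where "F = EA \<union> EB \<union> S"
  define G where "G = \<lparr>verts = A \<union> B, edges = F\<rparr>"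
  have fin: "finite EA" "finite EB" "finite S"
    using EA EB AB by (auto simp: S_def matching_def finite_pairs intro: finite_subset)
  have finF: "finite F" using fin by (simp add: F_def)
  have EA_A: "e \<subseteq> A \<and> \<not> crosses A e" if "e \<in> EA" for e
    using inA[OF that] unfolding crosses_def by blast
  have EB_A: "\<not> e \<subseteq> A \<and> \<not> crosses A e" if "e \<in> EB" for e
    using inB[OF that] AB(3) unfolding crosses_def by blast
  have S_A: "\<not> e \<subseteq> A \<and> crosses A e" if "e \<in> S" for e
    using S(1)[OF that] unfolding crosses_def by blast
  have disj: "EA \<inter> EB = {}" "(EA \<union> EB) \<inter> S = {}"
    using EA_A EB_A S_A by blast+
  have "simple_graph G"
  proof -
    have "e \<subseteq> A \<union> B \<and> card e = 2" if "e \<in> F" for e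
      using that EA(1) EB(1) S(3,4)[of e] unfolding F_def pairs_def by blast
    then show ?thesis using AB by (simp add: simple_graph_def G_def)
  qed
  \<comment> \<open>A cut that splits one of the sides has at least \<open>n - m\<close> edges,
    which exceeds both \<open>K\<close> and \<open>d\<close>.\<close>
  moreover have cut: "n \<le> m + card {e \<in> F. e \<inter> P \<noteq> {} \<and> e \<inter> Q \<noteq> {}}"
    if "X = A \<or> X = B" "X \<subseteq> P \<union> Q" "P \<inter> Q = {}" "P \<inter> X \<noteq> {}" "Q \<inter> X \<noteq> {}" for X P Q
    using that(1)
  proof
    assume "X = A" then show ?thesis
      using cut_almost_complete[of A P Q EA m F] that AB EA finF by (auto simp: F_def)
  next
    assume "X = B" then show ?thesis
      using cut_almost_complete[of B P Q EB m F] that AB EB finF by (auto simp: F_def)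
  qed
  have "edge_connected K G"
    unfolding edge_connected_def
  proof (intro conjI allI impI)
    show "card (verts G) \<ge> 2" using AB n by (simp add: G_def card_Un_disjoint)
  next
    fix P Q assume PQ: "P \<noteq> {} \<and> Q \<noteq> {} \<and> P \<inter> Q = {} \<and> P \<union> Q = verts G"
    let ?c = "{e \<in> F. e \<inter> P \<noteq> {} \<and> e \<inter> Q \<noteq> {}}"
    have "K \<le> card ?c"
    proof (cases "(P \<inter> A \<noteq> {} \<and> Q \<inter> A \<noteq> {}) \<or> (P \<inter> B \<noteq> {} \<and> Q \<inter> B \<noteq> {})")
      case True
      then have "n \<le> m + card ?c"
        using cut[of A P Q] cut[of B P Q] PQ by (auto simp: G_def)
      then show ?thesis using n by linarith
    next
      case False
      \<comment> \<open>If neither side is split, the cut separates \<open>A\<close> from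
        \<open>B\<close> and contains the whole matching.\<close>
      then have "(P = A \<and> Q = B) \<or> (P = B \<and> Q = A)"
        using PQ unfolding G_def graph.simps by blast
      then have "S \<subseteq> ?c" using S by (auto simp: F_def crosses_def)
      then have "card S \<le> card ?c" using finF by (intro card_mono) auto
      then show ?thesis unfolding S_def card_matching .
    qed
    then show "K \<le> card {e \<in> edges G. e \<inter> P \<noteq> {} \<and> e \<inter> Q \<noteq> {}}" by (simp add: G_def)
  qed
  moreover have "d \<le> min_degree G"
  proof -
    have "d \<le> degree G v" if "v \<in> A \<union> B" for v
    proof -
      obtain X where X: "X = A \<or> X = B" "v \<in> X" using \<open>v \<in> A \<union> B\<close> by blast
      then have "card X = n" using AB(4,5) by blast
      then have "card X \<noteq> 1" using n by linarith
      then have "X \<noteq> {v}" by auto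
      \<comment> \<open>The degree of \<open>v\<close> is bounded below through the cut isolating
        \<open>v\<close>.\<close>
      then have "n \<le> m + card {e \<in> F. e \<inter> {v} \<noteq> {} \<and> e \<inter> (- {v}) \<noteq> {}}"
        using X by (intro cut) auto
      also have "\<dots> \<le> m + degree G v"
        unfolding degree_def G_def using finF by (intro add_left_mono card_mono) auto
      finally show ?thesis using n by linarith
    qed
    moreover have "card A \<noteq> 0" using AB(4) n by linarith
    then have "A \<union> B \<noteq> {}" by auto
    ultimately show ?thesis using AB by (simp add: min_degree_def G_def)
  qed
  moreover have "m dvd card (edges G)"
  proof -
    have "card F = card EA + card EB + K"
      using card_Un_disjoint[OF finite_UnI[OF fin(1,2)] fin(3) disj(2)]
        card_Un_disjoint[OF fin(1,2) disj(1)] card_matching[of n K]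
      unfolding F_def S_def by linarith
    moreover have "(card EA + card EB + K) mod m = (r + s + K) mod m"
      unfolding EA(2)[symmetric] EB(2)[symmetric] by (intro mod_add_cong) simp_all
    ultimately show ?thesis using s unfolding G_def dvd_eq_mod_eq_0 graph.simps by argo
  qed
  moreover have "{e \<in> edges G. e \<subseteq> A} = EA"
    using EA_A EB_A S_A unfolding G_def F_def graph.simps by blast
  moreover have "{e \<in> edges G. crosses A e} = S"
    using EA_A EB_A S_A unfolding G_def F_def graph.simps by blast
  ultimately show ?thesis using EA(2) unfolding A_def S_def by (intro exI[of _ G]) simp
qed

section \<open>The counterexample\<close>

lemma tree_without_decomposition:
  fixes f :: "nat \<Rightarrow> nat"
  shows "\<exists>(T :: nat graph) (G :: nat graph).
    tree T \<and> max_degree T = 3 \<and> simple_graph G \<and> edge_connected K G \<and>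
    min_degree G \<ge> f (card (edges T)) \<and> card (edges T) dvd card (edges G) \<and>
    \<not> has_decomposition T G"
proof -
  \<comment> \<open>The order of choices matters: \<open>D\<close>, hence \<open>T\<close> and
    \<open>m\<close>, depends on \<open>K\<close> alone, so \<open>n\<close> can afterwards be taken
    large in terms of \<open>f m\<close>.\<close>
  obtain D :: nat where D: "D \<ge> 2" "(2 * D) ^ K < 2 ^ (D + 1) - 2"
    using power_lt_exponential by blast
  define m :: nat where "m = 2 ^ (D + 1) - 2"
  define T where "T = heap_tree (2 ^ (D + 1) - 1)"
  have "(2::nat) ^ 3 \<le> 2 ^ (D + 1)" using D by (intro power_increasing) auto
  then have "(2::nat) ^ (D + 1) - 1 \<ge> 5" by simp
  then have T: "tree T" "max_degree T = 3"
    unfolding T_def using max_degree_heap_tree by (auto intro: tree_heap_tree)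
  have Tm: "card (edges T) = m"
    unfolding T_def m_def card_edges_heap_tree by simp
  define n where "n = m + K + f m + 2"
  have "card (cut_values D) ^ K \<le> (2 * D) ^ K" by (rule power_mono[OF card_cut_values]) simp
  also have "\<dots> < m" unfolding m_def by (rule D(2))
  finally have "card (cut_values D) ^ card (matching n K) < m" unfolding card_matching .
  moreover have "finite (matching n K)" by (simp add: matching_def)
  ultimately obtain r where r: "r < m"
    and no: "\<And>c. (\<forall>e\<in>matching n K. c e \<in> cut_values D) \<Longrightarrow>
      \<not> int m dvd (int r - (\<Sum>e\<in>matching n K. c e))"
    using exists_unattainable_residue[OF _ finite_cut_values] by blast
  obtain G :: "nat graph" where G: "simple_graph G" "edge_connected K G" "min_degree G \<ge> f m"
      "m dvd card (edges G)" and GA: "card {e \<in> edges G. e \<subseteq> {..<n}} mod m = r"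
    and GS: "{e \<in> edges G. crosses {..<n} e} = matching n K"
    using exists_graph_with_sparse_cut[OF eq_refl[OF n_def[symmetric]] r] by blast
  have "\<not> has_decomposition T G"
  proof
    assume "has_decomposition T G"
    then obtain c where c: "\<forall>e\<in>edges G. c e \<in> cut_values D"
      and dvd: "int m dvd
        (int (card {e \<in> edges G. e \<subseteq> {..<n}}) - (\<Sum>e\<in>matching n K. c e))"
      using decomposition_cut_residue[OF G(1), of D "{..<n}"]
      unfolding T_def m_def GS by blast
    \<comment> \<open>Only the residue of the number of edges inside the first side is prescribed,
      so that number is exchanged for \<open>r\<close> modulo \<open>m\<close>.\<close>
    have "int m dvd (int r - int (card {e \<in> edges G. e \<subseteq> {..<n}}))"
      unfolding GA[symmetric] of_nat_mod mod_eq_dvd_iff[symmetric] by (rule mod_mod_trivial)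
    from dvd_add[OF this dvd] have "int m dvd (int r - (\<Sum>e\<in>matching n K. c e))" by simp
    moreover have "\<forall>e\<in>matching n K. c e \<in> cut_values D" using c GS by blast
    ultimately show False using no by blast
  qed
  then show ?thesis using T G unfolding Tm[symmetric] by blast
qed

theorem mainTheorem2:
  shows "(\<forall>f :: nat \<Rightarrow> nat. \<exists>(T :: nat graph) (G :: nat graph).
            tree T \<and> max_degree T = 3 \<and>
            simple_graph G \<and> edge_connected (f 3) G \<and>
            min_degree G \<ge> f (card (edges T)) \<and>
            card (edges T) dvd card (edges G) \<and>
            \<not> has_decomposition T G)
       \<and> \<not> (\<exists>f :: nat \<Rightarrow> nat. \<forall>(T :: nat graph) (G :: nat graph).
            tree T \<and>
            simple_graph G \<and> edge_connected (f (max_degree T)) G \<and>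
            min_degree G \<ge> f (card (edges T)) \<and>
            card (edges T) dvd card (edges G) \<longrightarrow>
            has_decomposition T G)"
proof (rule conjI)
  show "\<forall>f :: nat \<Rightarrow> nat. \<exists>(T :: nat graph) (G :: nat graph).
            tree T \<and> max_degree T = 3 \<and>
            simple_graph G \<and> edge_connected (f 3) G \<and>
            min_degree G \<ge> f (card (edges T)) \<and>
            card (edges T) dvd card (edges G) \<and>
            \<not> has_decomposition T G"
    by (intro allI tree_without_decomposition)
  show "\<not> (\<exists>f :: nat \<Rightarrow> nat. \<forall>(T :: nat graph) (G :: nat graph).
            tree T \<and>
            simple_graph G \<and> edge_connected (f (max_degree T)) G \<and>
            min_degree G \<ge> f (card (edges T)) \<and>
            card (edges T) dvd card (edges G) \<longrightarrow>
            has_decomposition T G)" (is "\<not> (\<exists>f. \<forall>T G. ?P f T G)")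
  proof
    assume "\<exists>f. \<forall>T G. ?P f T G"
    then obtain f where f: "\<And>T G. ?P f T G" by blast
    \<comment> \<open>All these trees have maximum degree 3, so the required connectivity is the
      constant \<open>f 3\<close>, known before \<open>T\<close> is chosen.\<close>
    obtain T G :: "nat graph" where TG: "tree T" "max_degree T = 3" "simple_graph G"
        "edge_connected (f 3) G" "min_degree G \<ge> f (card (edges T))"
        "card (edges T) dvd card (edges G)" "\<not> has_decomposition T G"
      using tree_without_decomposition[of "f 3" f] by blast
    then show False using f[of T G] by simp
  qed
qed

end
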